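(* Let $G$ be a graph, and let $H$ be an induced triangle-free subgraph of $G$ with minimum degree $\delta(H)\ge 3$. Then $$Z(G)\ \ge\ \delta(H)+1 .$$
   Context: All graphs are finite, undirected and simple. $\delta(H)$ denotes the minimum degree of $H$. A graph is triangle-free if it contains no $K_3$. Zero forcing number: let each vertex of $G$ be initially coloured black or white. Colour-change rule: if a black vertex $u$ has exactly one white neighbour $v$, then $v$ may be recoloured black ($u$ forces $v$). A set $B\subseteq V(G)$ is a zero forcing set if, starting with exactly the vertices of $B$ black, repeated application of the colour-change rule makes every vertex of $G$ black. The zero forcing number $Z(G)$ is the minimum size of a zero forcing set of $G$. *)

theory Defs
  imports "Graph_Theory.Graph_Theory"
begin

(* Finite simple undirected graphs are represented as in Graph_Theory: locale graph, i.e. finite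
   symmetric digraphs without loops and parallel arcs.  Each undirected edge is a pair of opposite
   arcs, so out_degree is the usual degree and dominates (u \<rightarrow>\<^bsub>G\<^esub> v) is adjacency. *)

(* The value 0 for the graph without vertices only avoids Min {}. *)
definition min_degree :: "('a, 'b) pre_digraph \<Rightarrow> nat" where
  "min_degree H = (if verts H = {} then 0 else Min (out_degree H ` verts H))"

definition triangle_free :: "('a, 'b) pre_digraph \<Rightarrow> bool" where
  "triangle_free H \<longleftrightarrow> \<not> (\<exists>K. subgraph K H \<and> complete_digraph 3 K)"

(* B is the current set of black vertices. *)
definition forces :: "('a, 'b) pre_digraph \<Rightarrow> 'a set \<Rightarrow> 'a \<Rightarrow> 'a \<Rightarrow> bool" where
  "forces G B u v \<longleftrightarrow> u \<in> B \<and> {w. u \<rightarrow>\<^bsub>G\<^esub> w \<and> w \<notin> B} = {v}"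

definition colour_change :: "('a, 'b) pre_digraph \<Rightarrow> 'a set \<Rightarrow> 'a set \<Rightarrow> bool" where
  "colour_change G B B' \<longleftrightarrow> (\<exists>u v. forces G B u v \<and> B' = insert v B)"

definition zero_forcing_set :: "('a, 'b) pre_digraph \<Rightarrow> 'a set \<Rightarrow> bool" where
  "zero_forcing_set G B \<longleftrightarrow> B \<subseteq> verts G \<and> (colour_change G)\<^sup>*\<^sup>* B (verts G)"

(* For finite G this is a minimum over a finite set, nonempty since verts G is zero forcing. *)
definition zero_forcing_number :: "('a, 'b) pre_digraph \<Rightarrow> nat" where
  "zero_forcing_number G = Min (card ` {B. zero_forcing_set G B})"

end

theory Submission
  imports Defs
begin

text \<open>
  Follow a forcing process and call a black vertex \<^emph>\<open>active\<close> if it is the current end of its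
  forcing chain.  When \<open>u\<close> forces \<open>v\<close>, the activity passes from \<open>u\<close> to \<open>v\<close>, so the number of active
  vertices never changes, and a black vertex that is no longer active has only black neighbours.

  Let \<open>d = \<delta>(H)\<close> and suppose that at most \<open>d\<close> vertices are black at the start.  Until a vertex of
  \<open>H\<close> performs a force, all black vertices of \<open>H\<close> are active, so at most \<open>d\<close> of the at least
  \<open>d + 1\<close> vertices of \<open>H\<close> are black; hence some vertex of \<open>H\<close> must force.  Let \<open>u\<close> be the first one,
  forcing \<open>v\<close>.  At that moment \<open>u\<close> and all its neighbours in \<open>H\<close> except possibly \<open>v\<close> are black
  vertices of \<open>H\<close>, hence active.  Counting leaves only one possibility: \<open>v\<close> is in \<open>H\<close>, and
  after the force the active vertices are exactly the neighbours of \<open>u\<close> in \<open>H\<close>, while \<open>u\<close> and these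
  neighbours are the only black vertices of \<open>H\<close>.  As \<open>H\<close> is triangle-free, a neighbour \<open>w\<close> of \<open>u\<close> has
  no neighbour among the other neighbours of \<open>u\<close>, so it has at least \<open>d - 1 \<ge> 2\<close> white neighbours.
  No active vertex can force, and the process stalls before all vertices are black
  (\<open>first_force_stalls\<close>).
\<close>

section \<open>Degrees and triangles\<close>

lemma (in digraph) out_degree_eq_card_neighbours:
  "out_degree G u = card {w. u \<rightarrow>\<^bsub>G\<^esub> w}"
proof -
  have "arc_to_ends G ` out_arcs G u = Pair u ` {w. u \<rightarrow>\<^bsub>G\<^esub> w}"
    by (auto simp: arc_to_ends_def arcs_ends_conv image_iff)
  moreover have "inj_on (arc_to_ends G) (out_arcs G u)"
    by (rule inj_on_subset[OF inj_on_arc_to_ends]) auto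
  moreover have "inj_on (Pair u) {w. u \<rightarrow>\<^bsub>G\<^esub> w}"
    by (rule inj_onI) auto
  ultimately show ?thesis
    unfolding out_degree_def by (metis card_image)
qed

lemma (in digraph) min_degree_le_card_neighbours:
  assumes "u \<in> verts G"
  shows "min_degree G \<le> card {w. u \<rightarrow>\<^bsub>G\<^esub> w}"
  using assms by (auto simp: min_degree_def out_degree_eq_card_neighbours[symmetric])

lemma (in fin_digraph) finite_neighbours: "finite {w. u \<rightarrow>\<^bsub>G\<^esub> w}"
  by (rule finite_subset[OF _ finite_verts]) (auto dest: adj_in_verts)

lemma (in digraph) min_degree_less_card_verts:
  assumes "verts G \<noteq> {}"
  shows "min_degree G < card (verts G)"
proof -
  obtain u where u: "u \<in> verts G"
    using assms by blast
  have "min_degree G \<le> card {w. u \<rightarrow>\<^bsub>G\<^esub> w}"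
    using u by (rule min_degree_le_card_neighbours)
  also have "\<dots> < card (verts G)"
    using u by (intro psubset_card_mono) (auto dest: adj_in_verts adj_not_same)
  finally show ?thesis .
qed

lemma (in graph) graph_induced:
  assumes "induced_subgraph H G"
  shows "graph H"
  using digraphI_induced[OF assms] induced_graph_imp_symmetric[OF sym_arcs assms]
  by (rule digraph.graphI)

lemma (in graph) triangle_free_no_triangle:
  assumes "triangle_free G" and uv: "u \<rightarrow>\<^bsub>G\<^esub> v" and uw: "u \<rightarrow>\<^bsub>G\<^esub> w" and vw: "v \<rightarrow>\<^bsub>G\<^esub> w"
  shows False
proof -
  let ?S = "{u, v, w}" and ?K = "G \<restriction> {u, v, w}"
  have S: "?S \<subseteq> verts G"
    using uv uw by (auto dest: adj_in_verts)
  have sub: "induced_subgraph ?K G"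
    using S by (rule induced_induce)
  have "graph ?K"
    using sub by (rule graph_induced)
  moreover have distinct: "u \<noteq> v" "u \<noteq> w" "v \<noteq> w"
    using uv uw vw adj_not_same by blast+
  then have "card ?S = 3"
    by simp
  moreover have "arcs_ends ?K = {(a, b). (a, b) \<in> ?S \<times> ?S \<and> a \<noteq> b}"
  proof -
    have ends: "arcs_ends ?K = {(a, b). a \<rightarrow>\<^bsub>G\<^esub> b \<and> a \<in> ?S \<and> b \<in> ?S}"
      by (auto simp: arcs_ends_conv image_iff)
    have "v \<rightarrow>\<^bsub>G\<^esub> u" "w \<rightarrow>\<^bsub>G\<^esub> u" "w \<rightarrow>\<^bsub>G\<^esub> v"
      using uv uw vw sym_arcs by (blast intro: arcs_ends_symmetric)+
    then show ?thesis
      unfolding ends using uv uw vw distinct adj_not_same by auto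
  qed
  ultimately have "complete_digraph 3 ?K"
    by (simp add: complete_digraph_def)
  then show False
    using assms(1) sub by (auto simp: triangle_free_def)
qed

lemma induced_subgraph_dominates_iff:
  assumes "induced_subgraph H G" "u \<in> verts H" "v \<in> verts H"
  shows "u \<rightarrow>\<^bsub>H\<^esub> v \<longleftrightarrow> u \<rightarrow>\<^bsub>G\<^esub> v"
  using assms
  by (auto simp: induced_subgraph_def subgraph_def compatible_def arcs_ends_conv image_iff)


section \<open>Active vertices\<close>

text \<open>
  The forcing chains are not recorded in a colour change, so the set of their ends is described
  by the one property used of it: black vertices outside it can never force.  Which such set is
  meant depends on the history; a force updates it by replacing \<open>u\<close> with \<open>v\<close>.
\<close>

definition active_set :: "('a, 'b) pre_digraph \<Rightarrow> 'a set \<Rightarrow> 'a set \<Rightarrow> bool" where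
  "active_set G B A \<longleftrightarrow> A \<subseteq> B \<and> (\<forall>u \<in> B - A. \<forall>w. u \<rightarrow>\<^bsub>G\<^esub> w \<longrightarrow> w \<in> B)"

lemma active_set_force:
  assumes "active_set G B A" and "forces G B u v"
  shows "u \<in> A" and "active_set G (insert v B) (insert v (A - {u}))"
proof -
  have u: "u \<in> B" "u \<rightarrow>\<^bsub>G\<^esub> v" and v: "v \<notin> B" and nb: "\<And>w. u \<rightarrow>\<^bsub>G\<^esub> w \<Longrightarrow> w \<in> insert v B"
    using assms(2) unfolding forces_def by blast+
  show "u \<in> A"
    using assms(1) u v by (auto simp: active_set_def)
  show "active_set G (insert v B) (insert v (A - {u}))"
    using assms(1) nb unfolding active_set_def by blast
qed

definition stalled :: "('a, 'b) pre_digraph \<Rightarrow> 'a set \<Rightarrow> bool" where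
  "stalled G B \<longleftrightarrow> \<not> verts G \<subseteq> B \<and> (\<forall>u v. \<not> forces G B u v)"


section \<open>The first force inside the subgraph\<close>

text \<open>
  The bound on the number of active vertices leaves no slack: \<open>u\<close> and its neighbours in \<open>H\<close> other
  than \<open>v\<close> already use up all of them.  Triangle-freeness and \<open>\<delta>(H) \<ge> 3\<close> then give each new active
  vertex two white neighbours, one more than a forcing vertex may have.
\<close>

lemma first_force_stalls:
  assumes G: "graph G" and H: "induced_subgraph H G"
    and tf: "triangle_free H" and deg: "min_degree H \<ge> 3"
    and A: "active_set G B A" "finite A" "card A \<le> min_degree H"
    and BH: "B \<inter> verts H \<subseteq> A"
    and force: "forces G B u v" and uH: "u \<in> verts H"
  shows "stalled G (insert v B)"
proof -
  interpret G: graph G by (fact G)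
  interpret H: graph H
    using H by (rule G.graph_induced)
  let ?N = "\<lambda>x. {y. x \<rightarrow>\<^bsub>H\<^esub> y}"
  have HG: "x \<rightarrow>\<^bsub>G\<^esub> y" if "x \<rightarrow>\<^bsub>H\<^esub> y" for x y
    using that induced_subgraph_dominates_iff[OF H] H.adj_in_verts by blast
  have uA: "u \<in> A"
    using active_set_force(1)[OF A(1) force] .
  have nb: "w \<in> insert v B" if "u \<rightarrow>\<^bsub>G\<^esub> w" for w
    using force that unfolding forces_def by blast
  have sub: "insert u (?N u - {v}) \<subseteq> A"
    using uA nb HG BH H.adj_in_verts by blast
  have uN: "u \<notin> ?N u"
    using H.adj_not_same by blast
  have degu: "min_degree H \<le> card (?N u)"
    using uH by (rule H.min_degree_le_card_neighbours)
  have card_le: "card (insert u (?N u - {v})) \<le> min_degree H"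
    using card_mono[OF A(2) sub] A(3) by linarith
  have vN: "v \<in> ?N u"
  proof (rule ccontr)
    assume "v \<notin> ?N u"
    then have "card (insert u (?N u - {v})) = Suc (card (?N u))"
      using uN H.finite_neighbours[of u] by simp
    then show False
      using card_le degu by linarith
  qed
  have "card (insert u (?N u - {v})) = card (?N u)"
    using uN card.remove[OF H.finite_neighbours vN] H.finite_neighbours[of u] by simp
  then have Aeq: "A = insert u (?N u - {v})"
    using sub A(2,3) degu by (intro card_seteq[symmetric]) auto
  \<comment> \<open>Now the active vertices after the force are exactly the neighbours of \<open>u\<close>.\<close>
  have act: "active_set G (insert v B) (?N u)"
  proof -
    have "insert v (A - {u}) = ?N u"
      using Aeq uN vN by auto
    then show ?thesis
      using active_set_force(2)[OF A(1) force] by simp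
  qed
  have black: "insert v B \<inter> verts H \<subseteq> insert u (?N u)"
    using BH Aeq vN by auto
  have white: "?N w - {u} \<subseteq> {y. w \<rightarrow>\<^bsub>G\<^esub> y \<and> y \<notin> insert v B}" if w: "w \<in> ?N u" for w
  proof
    fix y assume y: "y \<in> ?N w - {u}"
    have "\<not> u \<rightarrow>\<^bsub>H\<^esub> y"
      using w y H.triangle_free_no_triangle[OF tf] by blast
    then show "y \<in> {y. w \<rightarrow>\<^bsub>G\<^esub> y \<and> y \<notin> insert v B}"
      using y HG black H.adj_in_verts by blast
  qed
  have two: "card (?N w - {u}) \<ge> 2" if "w \<in> ?N u" for w
  proof -
    have "w \<in> verts H"
      using that H.adj_in_verts by blast
    then have "card (?N w) \<ge> 3"
      using H.min_degree_le_card_neighbours[of w] deg by linarith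
    then show ?thesis
      using diff_card_le_card_Diff[of "{u}" "?N w"] by simp
  qed
  have "\<not> forces G (insert v B) w x" for w x
  proof
    assume f: "forces G (insert v B) w x"
    then have w: "w \<in> ?N u"
      using active_set_force(1)[OF act] by blast
    have "?N w - {u} \<subseteq> {x}"
      using f white[OF w] by (simp add: forces_def)
    then have "card (?N w - {u}) \<le> 1"
      using card_mono[of "{x}"] by force
    then show False
      using two[OF w] by linarith
  qed
  moreover have "\<not> verts G \<subseteq> insert v B"
  proof -
    have "?N v - {u} \<noteq> {}"
      using two[OF vN] by (metis card.empty not_numeral_le_zero)
    then show ?thesis
      using white[OF vN] G.adj_in_verts by blast
  qed
  ultimately show ?thesis
    by (simp add: stalled_def)
qed


section \<open>The lower bound\<close>

lemma zero_forcing_set_card_gt_min_degree: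
  assumes G: "graph G" and H: "induced_subgraph H G"
    and tf: "triangle_free H" and deg: "min_degree H \<ge> 3"
    and zf: "zero_forcing_set G B"
  shows "min_degree H < card B"
proof (rule ccontr)
  assume "\<not> min_degree H < card B"
  then have small: "card B \<le> min_degree H"
    by simp
  interpret G: graph G by (fact G)
  interpret H: graph H
    using H by (rule G.graph_induced)
  \<comment> \<open>The state before any vertex of \<open>H\<close> has forced; the only way out of it is to stall.\<close>
  define early where "early B' \<longleftrightarrow> (\<exists>A. active_set G B' A \<and> finite A \<and> card A \<le> min_degree H
      \<and> B' \<inter> verts H \<subseteq> A)" for B'
  have "finite B"
    using zf finite_subset[OF _ G.finite_verts] by (auto simp: zero_forcing_set_def)
  then have "early B"
    using small unfolding early_def by (intro exI[of _ B]) (auto simp: active_set_def)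
  have "(colour_change G)\<^sup>*\<^sup>* B (verts G)"
    using zf by (simp add: zero_forcing_set_def)
  then have "early (verts G) \<or> stalled G (verts G)"
  proof (induction rule: rtranclp_induct)
    case base
    show ?case using \<open>early B\<close> by simp
  next
    case (step B' B'')
    obtain u v where force: "forces G B' u v" and B'': "B'' = insert v B'"
      using step.hyps(2) by (auto simp: colour_change_def)
    from force step.IH have "early B'"
      by (auto simp: stalled_def)
    then obtain A where A: "active_set G B' A" "finite A" "card A \<le> min_degree H"
      "B' \<inter> verts H \<subseteq> A"
      by (auto simp: early_def)
    show ?case
    proof (cases "u \<in> verts H")
      case True
      then show ?thesis
        using first_force_stalls[OF G H tf deg A force] B'' by simp
    next
      case False
      let ?A = "insert v (A - {u})"
      have "card ?A \<le> card A"
        using card.remove[OF A(2) active_set_force(1)[OF A(1) force]] A(2)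
        by (simp add: card_insert_if)
      then have "early B''"
        unfolding early_def B''
        using active_set_force(2)[OF A(1) force] A False by (intro exI[of _ ?A]) auto
      then show ?thesis ..
    qed
  qed
  then have "early (verts G)"
    by (auto simp: stalled_def)
  moreover have "verts H \<subseteq> verts G"
    using H by (auto simp: induced_subgraph_def subgraph_def)
  ultimately obtain A where "finite A" "card A \<le> min_degree H" "verts H \<subseteq> A"
    by (auto simp: early_def)
  then have "card (verts H) \<le> min_degree H"
    using card_mono[of A "verts H"] by linarith
  moreover have "verts H \<noteq> {}"
    using deg by (auto simp: min_degree_def)
  ultimately show False
    using H.min_degree_less_card_verts by simp
qed

theorem theorem2:
  fixes G H :: "('a, 'b) pre_digraph"
  assumes "graph G"
    and "induced_subgraph H G"
    and "triangle_free H"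
    and "min_degree H \<ge> 3"
  shows "zero_forcing_number G \<ge> min_degree H + 1"
proof -
  interpret G: graph G by (fact assms(1))
  let ?Z = "{B. zero_forcing_set G B}"
  have "finite ?Z"
    by (rule finite_subset[of _ "Pow (verts G)"]) (auto simp: zero_forcing_set_def)
  moreover have "verts G \<in> ?Z"
    by (simp add: zero_forcing_set_def)
  moreover have "min_degree H + 1 \<le> card B" if "B \<in> ?Z" for B
    using zero_forcing_set_card_gt_min_degree[OF assms] that by fastforce
  ultimately show ?thesis
    unfolding zero_forcing_number_def by (subst Min_ge_iff) auto
qed

end
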